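(* For every integer $m\ge 2$, every compact set $T\subset\mathbb{R}^n$ that is an intersection of $m$ semiellipsoids in $\mathbb{R}^n$ is a generalized ellipsoid of degree $d$ for some $d\le 2m-3$.
   Context: A set $T\subseteq\mathbb{R}^n$ is a semiellipsoid if $T=\{x\in\mathbb{R}^n\mid x^TPx\le 1\}$ for some positive semidefinite (real symmetric) matrix $P$. A set $\mathcal{E}_d\subset\mathbb{R}^n$ is a generalized ellipsoid of degree $d$ if it can be written as $\mathcal{E}_d=\{x\in\mathbb{R}^n\mid (x-x_0)^TP(t)(x-x_0)\le 1\ \ \forall t\in[-1,1]\}$ for some vector $x_0\in\mathbb{R}^n$ and some univariate polynomial matrix $P(t)$ (a real symmetric $n\times n$ matrix whose entries are polynomials in $t$) of degree at most $d$ that satisfies $P(t)\succeq 0$ for all $t\in[-1,1]$ and $\bigcap_{t\in[-1,1]}\mathrm{Ker}(P(t))=\{0\}$. *)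

theory Defs
  imports "HOL-Analysis.Analysis" "HOL-Computational_Algebra.Polynomial"
begin

definition psd :: "real ^ 'n ^ 'n \<Rightarrow> bool" where
  "psd A \<longleftrightarrow> transpose A = A \<and> (\<forall>x. 0 \<le> x \<bullet> (A *v x))"

definition semiellipsoid :: "(real ^ 'n) set \<Rightarrow> bool" where
  "semiellipsoid T \<longleftrightarrow> (\<exists>P. psd P \<and> T = {x. x \<bullet> (P *v x) \<le> 1})"

text \<open>A univariate polynomial matrix is a matrix with entries in \<^typ>\<open>real poly\<close>.\<close>

definition eval_polymat :: "real poly ^ 'n ^ 'n \<Rightarrow> real \<Rightarrow> real ^ 'n ^ 'n" where
  "eval_polymat P t = map_matrix (\<lambda>p. poly p t) P"

definition matrix_ker :: "real ^ 'n ^ 'n \<Rightarrow> (real ^ 'n) set" where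
  "matrix_ker A = {x. A *v x = 0}"

text \<open>Here \<open>d\<close> is an upper bound on the degree of the polynomial matrix, so that a
  generalized ellipsoid of degree \<open>d\<close> is also one of every larger degree. The zero polynomial
  has degree \<open>0\<close>.\<close>

definition generalized_ellipsoid :: "nat \<Rightarrow> (real ^ 'n) set \<Rightarrow> bool" where
  "generalized_ellipsoid d E \<longleftrightarrow>
     (\<exists>(x0 :: real ^ 'n) (P :: real poly ^ 'n ^ 'n).
        transpose P = P \<and>
        (\<forall>i j. degree (P $ i $ j) \<le> d) \<and>
        (\<forall>t\<in>{-1..1}. psd (eval_polymat P t)) \<and>
        (\<Inter>t\<in>{-1..1}. matrix_ker (eval_polymat P t)) = {0} \<and>
        E = {x. \<forall>t\<in>{-1..1}. (x - x0) \<bullet> (eval_polymat P t *v (x - x0)) \<le> 1})"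

end

theory Submission
  imports Defs
begin

text \<open>
  Let the semiellipsoids be given by the matrices \<open>M\<^sub>1, \<dots>, M\<^sub>m\<close>. Suppose \<open>w\<^sub>1, \<dots>, w\<^sub>m\<close> are
  polynomials that are nonnegative on \<open>[-1, 1]\<close>, add up to \<open>1\<close>, and satisfy \<open>w\<^sub>i(t\<^sub>i) = 1\<close> for
  some nodes \<open>t\<^sub>i \<in> [-1, 1]\<close>. Then \<open>P(t) = \<Sum>\<^sub>i w\<^sub>i(t) M\<^sub>i\<close> runs through the convex hull of the \<open>M\<^sub>i\<close>
  and passes through each of them, so the constraints \<open>v\<^sup>T P(t) v \<le> 1\<close> together say the same as
  the \<open>m\<close> given ones (\<open>generalized_ellipsoid_if_interpolating_weights\<close>, with center \<open>0\<close>).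

  It remains to find such weights of degree at most \<open>2m - 3\<close>
  (\<open>exists_interpolating_partition_of_unity\<close>). The nodes are \<open>-1\<close>, \<open>1\<close> and \<open>m - 2\<close> interior
  points. Nonnegativity makes each \<open>w\<^sub>i\<close> vanish doubly at the interior nodes other than \<open>t\<^sub>i\<close> and
  at least simply at the end points other than \<open>t\<^sub>i\<close>. The products of these factors, normalized
  at \<open>t\<^sub>i\<close>, have degree \<open>2m - 4\<close> for interior and \<open>2m - 3\<close> for end nodes. Their sum is \<open>1\<close> at
  all nodes, and if its derivative vanishes at the interior nodes as well, then the sum
  minus \<open>1\<close> has \<open>2(m - 2) + 2\<close> zeros with multiplicity, more than its degree, so it is \<open>0\<close>.

  The derivative condition concerns only \<open>w\<^sub>i'(t\<^sub>i) = 0\<close>, and it determines the choice of the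
  interior nodes: they maximize \<open>\<Prod>\<^sub>i (1 - t\<^sub>i\<^sup>2) \<Prod>\<^bsub>i<j\<^esub> (t\<^sub>i - t\<^sub>j)\<^sup>2\<close> on a compact cube
  (\<open>exists_fekete_nodes\<close>). As a function of \<open>t\<^sub>i\<close> alone this is a positive multiple of
  \<open>w\<^sub>i\<close>, which therefore attains its maximum at \<open>t\<^sub>i\<close>.
\<close>

section \<open>Fekete nodes\<close>

text \<open>
  The nodes exist because a continuous function on the cube \<open>[-1, 1]\<^sup>k\<close> has a maximizer. The
  maximum is positive, so the coordinates of a maximizer are distinct and interior; varying
  one coordinate at a time gives the inequality. The weight \<open>1 - x\<^sup>2\<close> lets the end
  points act as two further, fixed nodes, each to the first power only.
\<close>

lemma exists_fekete_nodes:
  "\<exists>X :: real set. finite X \<and> card X = k \<and> X \<subseteq> {-1<..<1} \<and>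
     (\<forall>x\<in>X. \<forall>s\<in>{-1..1}. (1 - s\<^sup>2) * (\<Prod>y\<in>X - {x}. (s - y)\<^sup>2) \<le> (1 - x\<^sup>2) * (\<Prod>y\<in>X - {x}. (x - y)\<^sup>2))"
proof -
  define G :: "(nat \<Rightarrow> real) \<Rightarrow> real" where
    "G x = (\<Prod>i<k. (1 - (x i)\<^sup>2) * (\<Prod>j\<in>{..<k} - {i}. \<bar>x i - x j\<bar>))" for x
  define K :: "(nat \<Rightarrow> real) set" where "K = Pi UNIV (\<lambda>_. {-1..1})"
  \<comment> \<open>Taking the cube in all of \<open>nat \<Rightarrow> real\<close> avoids restricting functions to \<open>{..<k}\<close>; it is
     still compact, by Tychonoff.\<close>
  have "compact K"
    using compactin_PiE[of "\<lambda>_. euclidean" UNIV "\<lambda>_::nat. {-1..1::real}"]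
    by (simp add: euclidean_product_topology K_def PiE_UNIV_domain)
  moreover have "K \<noteq> {}"
    by (auto simp: K_def intro!: exI[of _ "\<lambda>_. 0"])
  moreover have "continuous_on K G"
    unfolding G_def
    by (intro continuous_intros continuous_on_subset[OF continuous_on_product_coordinates]) auto
  ultimately obtain x where x: "x \<in> K" and max: "\<And>y. y \<in> K \<Longrightarrow> G y \<le> G x"
    using continuous_attains_sup by metis
  have xb: "\<bar>x i\<bar> \<le> 1" for i
    using x by (auto simp: K_def Pi_iff abs_le_iff minus_le_iff)
  have Gpos: "0 < G x"
  proof -
    define z :: "nat \<Rightarrow> real" where "z i = 1 / (real i + 2)" for i
    have "\<bar>z i\<bar> < 1" for i by (simp add: z_def)
    then have "0 < 1 - (z i)\<^sup>2" for i
      using abs_square_less_1[of "z i"] by (metis diff_gt_0_iff_gt)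
    moreover have "z i \<noteq> z j" if "i \<noteq> j" for i j
      using that by (simp add: z_def)
    ultimately have "0 < G z"
      unfolding G_def by (intro prod_pos ballI mult_pos_pos) auto
    moreover have "z \<in> K"
      by (auto simp: K_def z_def) (smt (verit) divide_nonneg_nonneg of_nat_0_le_iff)
    ultimately show ?thesis using max by fastforce
  qed
  have nz: "(1 - (x i)\<^sup>2) * (\<Prod>j\<in>{..<k} - {i}. \<bar>x i - x j\<bar>) \<noteq> 0" if "i < k" for i
  proof (rule notI)
    assume "(1 - (x i)\<^sup>2) * (\<Prod>j\<in>{..<k} - {i}. \<bar>x i - x j\<bar>) = 0"
    then have "G x = 0"
      unfolding G_def by (rule prod_zero[OF finite_lessThan bexI]) (simp add: that)
    then show False using Gpos by simp
  qed
  have interior: "\<bar>x i\<bar> < 1" if "i < k" for i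
  proof -
    have "(x i)\<^sup>2 \<noteq> 1" using nz[OF that] by auto
    then show ?thesis using xb[of i] by (simp add: abs_square_eq_1 less_le)
  qed
  have distinct: "x i \<noteq> x j" if "i < k" "j < k" "i \<noteq> j" for i j
    using nz[OF that(1)] that by auto
  have inj: "inj_on x {..<k}"
    using distinct by (auto simp: inj_on_def)
  \<comment> \<open>Each difference \<open>x i - x j\<close> occurs twice in \<open>G x\<close>, so as a function of one coordinate
     \<open>G\<close> is a constant multiple of the polynomial in question.\<close>
  have fact: "G (x(i := s)) = (1 - s\<^sup>2) * (\<Prod>j\<in>{..<k} - {i}. (s - x j)\<^sup>2) *
      (\<Prod>l\<in>{..<k} - {i}. (1 - (x l)\<^sup>2) * (\<Prod>j\<in>{..<k} - {l} - {i}. \<bar>x l - x j\<bar>))"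
    if i: "i < k" for i s
  proof -
    let ?y = "x(i := s)"
    have "G ?y = (1 - s\<^sup>2) * (\<Prod>j\<in>{..<k} - {i}. \<bar>s - x j\<bar>) *
        (\<Prod>l\<in>{..<k} - {i}. (1 - (?y l)\<^sup>2) * (\<Prod>j\<in>{..<k} - {l}. \<bar>?y l - ?y j\<bar>))"
      unfolding G_def using i by (subst prod.remove[of _ i]) auto
    also have "(\<Prod>l\<in>{..<k} - {i}. (1 - (?y l)\<^sup>2) * (\<Prod>j\<in>{..<k} - {l}. \<bar>?y l - ?y j\<bar>))
      = (\<Prod>l\<in>{..<k} - {i}. \<bar>s - x l\<bar> *
          ((1 - (x l)\<^sup>2) * (\<Prod>j\<in>{..<k} - {l} - {i}. \<bar>x l - x j\<bar>)))"
    proof (rule prod.cong[OF refl])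
      fix l assume l: "l \<in> {..<k} - {i}"
      have "(\<Prod>j\<in>{..<k} - {l}. \<bar>?y l - ?y j\<bar>) = \<bar>x l - s\<bar> * (\<Prod>j\<in>{..<k} - {l} - {i}. \<bar>x l - x j\<bar>)"
        using l i by (subst prod.remove[of _ i]) auto
      then show "(1 - (?y l)\<^sup>2) * (\<Prod>j\<in>{..<k} - {l}. \<bar>?y l - ?y j\<bar>) =
          \<bar>s - x l\<bar> * ((1 - (x l)\<^sup>2) * (\<Prod>j\<in>{..<k} - {l} - {i}. \<bar>x l - x j\<bar>))"
        using l by (simp add: abs_minus_commute)
    qed
    finally have G: "G ?y = (1 - s\<^sup>2) * (\<Prod>j\<in>{..<k} - {i}. \<bar>s - x j\<bar>) *
        (\<Prod>l\<in>{..<k} - {i}. \<bar>s - x l\<bar> *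
          ((1 - (x l)\<^sup>2) * (\<Prod>j\<in>{..<k} - {l} - {i}. \<bar>x l - x j\<bar>)))" .
    have sq: "(\<Prod>j\<in>{..<k} - {i}. (s - x j)\<^sup>2)
      = (\<Prod>j\<in>{..<k} - {i}. \<bar>s - x j\<bar>) * (\<Prod>j\<in>{..<k} - {i}. \<bar>s - x j\<bar>)"
      by (simp add: prod.distrib[symmetric] power2_eq_square)
    show ?thesis
      unfolding G sq by (simp add: prod.distrib mult_ac)
  qed
  have opt: "(1 - s\<^sup>2) * (\<Prod>j\<in>{..<k} - {i}. (s - x j)\<^sup>2) \<le> (1 - (x i)\<^sup>2) * (\<Prod>j\<in>{..<k} - {i}. (x i - x j)\<^sup>2)"
    if i: "i < k" and s: "s \<in> {-1..1}" for i s
  proof -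
    define R where "R = (\<Prod>l\<in>{..<k} - {i}. (1 - (x l)\<^sup>2) * (\<Prod>j\<in>{..<k} - {l} - {i}. \<bar>x l - x j\<bar>))"
    have "R > 0"
      unfolding R_def using interior distinct
      by (intro prod_pos ballI mult_pos_pos) (auto simp: abs_square_less_1)
    moreover have "x(i := s) \<in> K"
      using x s by (auto simp: K_def)
    ultimately show ?thesis
      using max[of "x(i := s)"] fact[OF i, of s] fact[OF i, of "x i"]
      by (simp add: R_def[symmetric])
  qed
  have minus: "x ` {..<k} - {x i} = x ` ({..<k} - {i})" if "i < k" for i
    using distinct that by auto
  have "(1 - s\<^sup>2) * (\<Prod>y\<in>x ` {..<k} - {x i}. (s - y)\<^sup>2)
      \<le> (1 - (x i)\<^sup>2) * (\<Prod>y\<in>x ` {..<k} - {x i}. (x i - y)\<^sup>2)"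
    if "i < k" "s \<in> {-1..1}" for i s
    using opt[OF that]
    by (simp add: minus[OF that(1)] prod.reindex[OF inj_on_subset[OF inj Diff_subset]])
  moreover have "x ` {..<k} \<subseteq> {-1<..<1}"
    using interior by (auto simp: abs_less_iff minus_less_iff)
  ultimately show ?thesis
    using inj by (intro exI[of _ "x ` {..<k}"]) (auto simp: card_image)
qed

section \<open>Nonnegative interpolating weights\<close>

lemma poly_eq_0_if_double_roots:
  fixes p :: "real poly"
  assumes X: "finite X" and Y: "finite Y" "X \<inter> Y = {}"
    and dbl: "\<And>x. x \<in> X \<Longrightarrow> poly p x = 0 \<and> poly (pderiv p) x = 0"
    and simple: "\<And>y. y \<in> Y \<Longrightarrow> poly p y = 0"
    and deg: "degree p < 2 * card X + card Y"
  shows "p = 0"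
proof (rule ccontr)
  assume p: "p \<noteq> 0"
  have dX: "2 \<le> order x p" if "x \<in> X" for x
  proof -
    have "pderiv p \<noteq> 0"
    proof
      assume "pderiv p = 0"
      then obtain h where "p = [:h:]" using pderiv_iszero by blast
      then show False using p dbl[OF that] by simp
    qed
    then have "order x (pderiv p) \<noteq> 0"
      using dbl[OF that] order_root by blast
    then show ?thesis using order_pderiv[OF p, of x] dbl[OF that] by simp
  qed
  have dY: "1 \<le> order y p" if "y \<in> Y" for y
    using simple[OF that] p order_root by (metis One_nat_def Suc_leI not_gr0)
  have "2 * card X + card Y = (\<Sum>x\<in>X. 2) + (\<Sum>y\<in>Y. 1)" by simp
  also have "\<dots> \<le> (\<Sum>x\<in>X. order x p) + (\<Sum>y\<in>Y. order y p)"
    using dX dY by (intro add_mono sum_mono) auto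
  also have "\<dots> = (\<Sum>x\<in>X \<union> Y. order x p)"
    using X Y by (simp add: sum.union_disjoint)
  also have "\<dots> \<le> (\<Sum>x | poly p x = 0. order x p)"
    using dbl simple by (intro sum_mono2 poly_roots_finite p) auto
  also have "\<dots> \<le> degree p" by (rule sum_order_le_degree[OF p])
  finally show False using deg by simp
qed

text \<open>
  The weight of a node \<open>x\<close> is the product of the least factors that are nonnegative on
  \<open>[-1, 1]\<close> and vanish at the other nodes. At the interior nodes all weights have derivative
  \<open>0\<close>: at the other nodes because of the double zero, at \<open>x\<close> itself because Fekete nodes make
  \<open>x\<close> a maximum. This makes the weights add up to \<open>1\<close> by counting zeros.
\<close>

lemma exists_interpolating_partition_of_unity:
  "\<exists>(N :: real set) w. finite N \<and> card N = k + 2 \<and> N \<subseteq> {-1..1} \<and>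
     (\<forall>x\<in>N. degree (w x) \<le> 2 * k + 1 \<and> poly (w x) x = 1 \<and> (\<forall>s\<in>{-1..1}. 0 \<le> poly (w x) s)) \<and>
     (\<Sum>x\<in>N. w x) = (1 :: real poly)"
proof -
  obtain X :: "real set" where X: "finite X" "card X = k" "X \<subseteq> {-1<..<1}"
    and fek: "\<And>x s. x \<in> X \<Longrightarrow> s \<in> {-1..1} \<Longrightarrow>
      (1 - s\<^sup>2) * (\<Prod>y\<in>X - {x}. (s - y)\<^sup>2) \<le> (1 - x\<^sup>2) * (\<Prod>y\<in>X - {x}. (x - y)\<^sup>2)"
    using exists_fekete_nodes[of k] by blast
  define N where "N = X \<union> {-1, 1}"
  have disj: "X \<inter> {-1, 1} = {}" using X by auto
  have fin: "finite N" and card: "card N = k + 2" and sub: "N \<subseteq> {-1..1}"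
    using X disj by (auto simp: N_def card_Un_disjoint)
  \<comment> \<open>For \<open>x = 1\<close> and \<open>x = -1\<close> the factor \<open>1 + x t\<close> is the one that vanishes at the opposite
     end point.\<close>
  define B where "B x = (if x \<in> X then [:1, 0, -1:] else [:1, x:]) * (\<Prod>y\<in>X - {x}. [:- y, 1:]\<^sup>2)" for x :: real
  define w where "w x = smult (inverse (poly (B x) x)) (B x)" for x
  have polyB: "poly (B x) s = (if x \<in> X then 1 - s\<^sup>2 else 1 + s * x) * (\<Prod>y\<in>X - {x}. (s - y)\<^sup>2)" for x s
    by (auto simp: B_def poly_prod poly_power power2_eq_square[of s])
  have degprod: "degree (\<Prod>y\<in>A. [:- y, 1:]\<^sup>2) = 2 * card A" for A :: "real set"
    by (subst degree_prod_eq_sum_degree) (auto simp: degree_power_eq)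
  have degB: "degree (B x) \<le> 2 * k + 1" if "x \<in> N" for x
  proof (cases "x \<in> X")
    case True
    then have "card X > 0" using X by (auto simp: card_gt_0_iff)
    moreover have "degree (B x) \<le> degree [:1, 0, -1 :: real:] + 2 * card (X - {x})"
      unfolding B_def degprod[symmetric] using True by (simp only: if_True degree_mult_le)
    ultimately show ?thesis using True X by simp
  next
    case False
    have "degree (B x) \<le> degree [:1, x:] + 2 * card (X - {x})"
      unfolding B_def degprod[symmetric] using False by (simp only: if_False degree_mult_le)
    then show ?thesis using False X by (simp split: if_splits)
  qed
  have Bpos: "0 < poly (B x) x" if "x \<in> N" for x
  proof -
    have "0 < (if x \<in> X then 1 - x\<^sup>2 else 1 + x * x)"
      using X by (auto simp: abs_square_less_1 abs_less_iff add_pos_nonneg minus_less_iff)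
    moreover have "0 < (\<Prod>y\<in>X - {x}. (x - y)\<^sup>2)"
      by (intro prod_pos) auto
    ultimately show ?thesis unfolding polyB by (rule mult_pos_pos)
  qed
  have Bnonneg: "0 \<le> poly (B x) s" if "x \<in> N" "s \<in> {-1..1}" for x s
  proof -
    have "0 \<le> (if x \<in> X then 1 - s\<^sup>2 else 1 + s * x)"
      using that by (auto simp: N_def abs_square_le_1 abs_le_iff minus_le_iff)
    then show ?thesis unfolding polyB by (intro mult_nonneg_nonneg prod_nonneg) auto
  qed
  have Bzero: "poly (B x) y = 0" if "x \<in> N" "y \<in> N" "x \<noteq> y" for x y
  proof (cases "y \<in> X")
    case True
    then have "(\<Prod>z\<in>X - {x}. (y - z)\<^sup>2) = 0"
      using that X by (intro prod_zero) auto
    then show ?thesis by (simp add: polyB)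
  next
    case False
    then have "(if x \<in> X then 1 - y\<^sup>2 else 1 + y * x) = 0"
      using that by (auto simp: N_def)
    then show ?thesis by (simp add: polyB)
  qed
  have Bderiv: "poly (pderiv (B x)) y = 0" if xy: "x \<in> N" "y \<in> X" for x y
  proof (cases "x = y")
    case True
    have "\<forall>s. \<bar>y - s\<bar> < min (1 - y) (1 + y) \<longrightarrow> poly (B x) s \<le> poly (B x) y"
    proof (intro allI impI)
      fix s assume "\<bar>y - s\<bar> < min (1 - y) (1 + y)"
      then have "s \<in> {-1..1}" by auto
      then show "poly (B x) s \<le> poly (B x) y"
        using fek[OF xy(2), of s] xy True by (simp add: polyB)
    qed
    moreover have "0 < min (1 - y) (1 + y)" using xy X by auto
    ultimately show ?thesis using DERIV_local_max[OF poly_DERIV] by blast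
  next
    case False
    then have "(\<Prod>z\<in>X - {x}. [:- z, 1:]\<^sup>2) = [:- y, 1:]\<^sup>2 * (\<Prod>z\<in>X - {x} - {y}. [:- z, 1:]\<^sup>2)"
      using xy X by (intro prod.remove) auto
    then have "[:- y, 1:]\<^sup>2 dvd B x"
      unfolding B_def by (intro dvd_mult) (rule dvdI)
    then obtain q where "B x = [:- y, 1:] * ([:- y, 1:] * q)"
      by (auto simp only: power2_eq_square mult.assoc elim!: dvdE)
    then show ?thesis
      by (simp only: pderiv_mult poly_add poly_mult) simp
  qed
  have wx: "poly (w x) x = 1" if "x \<in> N" for x
    using Bpos[OF that] by (simp add: w_def)
  have "(\<Sum>x\<in>N. w x) - 1 = 0"
  proof (rule poly_eq_0_if_double_roots[of X "{-1, 1}"])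
    show "finite X" "finite {-1, 1::real}" "X \<inter> {-1, 1} = {}" using X disj by auto
    have val: "poly ((\<Sum>x\<in>N. w x) - 1) y = 0" if "y \<in> N" for y
    proof -
      have "(\<Sum>x\<in>N. poly (w x) y) = (\<Sum>x\<in>N. if x = y then 1 else 0)"
        using that wx Bzero by (intro sum.cong) (auto simp: w_def)
      then show ?thesis using that fin by (simp add: poly_sum)
    qed
    show "poly ((\<Sum>x\<in>N. w x) - 1) y = 0" if "y \<in> {-1, 1}" for y
      using val that by (auto simp: N_def)
    have "pderiv ((\<Sum>x\<in>N. w x) - 1) = (\<Sum>x\<in>N. pderiv (w x))"
      using higher_pderiv_sum[of 1 w N] by (simp add: pderiv_diff)
    then show "poly ((\<Sum>x\<in>N. w x) - 1) y = 0 \<and> poly (pderiv ((\<Sum>x\<in>N. w x) - 1)) y = 0" if "y \<in> X" for y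
      using val[of y] that Bderiv
      by (simp add: N_def w_def pderiv_smult poly_sum)
    have "degree ((\<Sum>x\<in>N. w x) - 1) \<le> 2 * k + 1"
      using degB fin by (intro degree_diff_le degree_sum_le) (auto simp: w_def)
    then show "degree ((\<Sum>x\<in>N. w x) - 1) < 2 * card X + card {-1, 1::real}"
      using X by simp
  qed
  then have "(\<Sum>x\<in>N. w x) = 1" by simp
  moreover have "degree (w x) \<le> 2 * k + 1" if "x \<in> N" for x
    using degB[OF that] by (simp add: w_def)
  moreover have "0 \<le> poly (w x) s" if "x \<in> N" "s \<in> {-1..1}" for x s
    using Bpos[OF that(1)] Bnonneg[OF that] by (simp add: w_def)
  ultimately show ?thesis
    using fin card sub wx by blast
qed

section \<open>Semiellipsoids as values of one polynomial matrix\<close>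

lemma bounded_line_eq_0:
  fixes x :: "'a :: real_normed_vector"
  assumes "bounded T" and line: "\<And>c. c *\<^sub>R x \<in> T"
  shows "x = 0"
proof (rule ccontr)
  assume "x \<noteq> 0"
  obtain b where b: "\<And>y. y \<in> T \<Longrightarrow> norm y \<le> b"
    using assms(1) by (auto simp: bounded_iff)
  have "norm (((\<bar>b\<bar> + 1) / norm x) *\<^sub>R x) \<le> b"
    by (intro b line)
  then show False using \<open>x \<noteq> 0\<close> by simp
qed

text \<open>
  The matrix polynomial is \<open>P t = (\<Sum>x\<in>N. w x t M x)\<close>. Each of its values is a convex
  combination of the \<open>M x\<close>, so it imposes no constraint beyond those of the \<open>M x\<close>. Since the
  weights are nonnegative and add up to \<open>1\<close>, the equation \<open>w x x = 1\<close> forces all other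
  weights to vanish at \<open>x\<close>; hence \<open>P x = M x\<close>, and every constraint occurs. A common kernel
  vector would span a line inside \<open>T\<close>, which boundedness excludes.
\<close>

lemma generalized_ellipsoid_if_interpolating_weights:
  fixes T :: "(real ^ 'n) set" and M :: "real \<Rightarrow> real ^ 'n ^ 'n" and w :: "real \<Rightarrow> real poly"
  assumes N: "finite N" "N \<subseteq> {-1..1}"
    and deg: "\<And>x. x \<in> N \<Longrightarrow> degree (w x) \<le> d"
    and one: "\<And>x. x \<in> N \<Longrightarrow> poly (w x) x = 1"
    and nonneg: "\<And>x s. x \<in> N \<Longrightarrow> s \<in> {-1..1} \<Longrightarrow> 0 \<le> poly (w x) s"
    and sum1: "(\<Sum>x\<in>N. w x) = 1"
    and psd: "\<And>x. x \<in> N \<Longrightarrow> psd (M x)"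
    and T: "T = {v. \<forall>x\<in>N. v \<bullet> (M x *v v) \<le> 1}"
    and bdd: "bounded T"
  shows "generalized_ellipsoid d T"
proof -
  have sym: "transpose (M x) = M x" and pos: "0 \<le> v \<bullet> (M x *v v)" if "x \<in> N" for x v
    using psd[OF that] by (auto simp: psd_def)
  define P :: "real poly ^ 'n ^ 'n" where "P = (\<chi> a b. \<Sum>x\<in>N. smult (M x $ a $ b) (w x))"
  have nth: "eval_polymat P t $ a $ b = (\<Sum>x\<in>N. poly (w x) t * M x $ a $ b)" for t a b
    by (simp add: eval_polymat_def map_matrix_def P_def poly_sum mult.commute)
  have mult: "eval_polymat P t *v v = (\<Sum>x\<in>N. poly (w x) t *\<^sub>R (M x *v v))" for t v
  proof (rule vec_eq_iff[THEN iffD2], rule allI)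
    fix a
    have "(eval_polymat P t *v v) $ a = (\<Sum>b\<in>UNIV. \<Sum>x\<in>N. poly (w x) t * M x $ a $ b * v $ b)"
      by (simp add: matrix_vector_mult_def nth sum_distrib_right)
    also have "\<dots> = (\<Sum>x\<in>N. \<Sum>b\<in>UNIV. poly (w x) t * M x $ a $ b * v $ b)"
      by (rule sum.swap)
    also have "\<dots> = (\<Sum>x\<in>N. poly (w x) t *\<^sub>R (M x *v v)) $ a"
      by (simp add: matrix_vector_mult_def sum_distrib_left mult.assoc)
    finally show "(eval_polymat P t *v v) $ a = (\<Sum>x\<in>N. poly (w x) t *\<^sub>R (M x *v v)) $ a" .
  qed
  have quad: "v \<bullet> (eval_polymat P t *v v) = (\<Sum>x\<in>N. poly (w x) t * (v \<bullet> (M x *v v)))" for t v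
    by (simp add: mult inner_sum_right)
  have wsum: "(\<Sum>x\<in>N. poly (w x) t) = 1" for t
    using arg_cong[OF sum1, of "\<lambda>p. poly p t"] by (simp add: poly_sum)
  have at_node: "eval_polymat P x *v v = M x *v v" if x: "x \<in> N" for x v
  proof -
    have "(\<Sum>y\<in>N - {x}. poly (w y) x) = 0"
      using wsum[of x] one[OF x] N x by (simp add: sum.remove[of N x])
    moreover have "0 \<le> poly (w y) x" if "y \<in> N" for y
      using nonneg[OF that] x N by auto
    ultimately have "poly (w y) x = 0" if "y \<in> N - {x}" for y
      using that N by (subst (asm) sum_nonneg_eq_0_iff) auto
    then show ?thesis
      unfolding mult using N x one[OF x] by (simp add: sum.remove[of N x])
  qed
  have symP: "transpose P = P"
  proof -
    have "M x $ b $ a = M x $ a $ b" if "x \<in> N" for x a b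
      using arg_cong[OF sym[OF that], of "\<lambda>Q. Q $ a $ b"] by (simp add: transpose_def)
    then show ?thesis by (simp add: vec_eq_iff transpose_def P_def cong: sum.cong)
  qed
  have degP: "degree (P $ a $ b) \<le> d" for a b
    unfolding P_def using deg N
    by (auto intro!: degree_sum_le order.trans[OF degree_smult_le])
  have psdP: "psd (eval_polymat P t)" if "t \<in> {-1..1}" for t
  proof -
    have "transpose (eval_polymat P t) = eval_polymat P t"
      using symP by (simp add: vec_eq_iff transpose_def eval_polymat_def map_matrix_def)
    then show ?thesis
      unfolding psd_def quad using nonneg that pos by (auto intro!: sum_nonneg)
  qed
  have Teq: "T = {v. \<forall>t\<in>{-1..1}. v \<bullet> (eval_polymat P t *v v) \<le> 1}"
  proof (intro equalityI subsetI CollectI ballI)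
    fix v t assume v: "v \<in> T" and t: "t \<in> {-1..1::real}"
    have "v \<bullet> (eval_polymat P t *v v) \<le> (\<Sum>x\<in>N. poly (w x) t * 1)"
      unfolding quad using v nonneg t by (intro sum_mono mult_left_mono) (auto simp: T)
    then show "v \<bullet> (eval_polymat P t *v v) \<le> 1" by (simp add: wsum)
  next
    fix v assume v: "v \<in> {v. \<forall>t\<in>{-1..1}. v \<bullet> (eval_polymat P t *v v) \<le> 1}"
    then show "v \<in> T" unfolding T using N at_node by fastforce
  qed
  have ker: "(\<Inter>t\<in>{-1..1}. matrix_ker (eval_polymat P t)) = {0}"
  proof (intro equalityI subsetI)
    fix v assume v: "v \<in> (\<Inter>t\<in>{-1..1}. matrix_ker (eval_polymat P t))"
    have "M x *v v = 0" if "x \<in> N" for x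
    proof -
      have "v \<in> matrix_ker (eval_polymat P x)" using v that N by blast
      then show ?thesis by (simp add: matrix_ker_def at_node[OF that])
    qed
    then have "c *\<^sub>R v \<in> T" for c
      by (simp add: T matrix_vector_mult_scaleR)
    then have "v = 0"
      using bounded_line_eq_0 bdd by blast
    then show "v \<in> {0}" by simp
  qed (simp add: matrix_ker_def)
  show ?thesis
    unfolding generalized_ellipsoid_def
  proof (intro exI conjI)
    show "T = {x. \<forall>t\<in>{-1..1}. (x - 0) \<bullet> (eval_polymat P t *v (x - 0)) \<le> 1}"
      unfolding diff_zero by (rule Teq)
  qed (use symP degP psdP ker in blast)+
qed

theorem theorem5p1:
  fixes m :: nat
    and T :: "(real ^ 'n) set"
    and S :: "nat \<Rightarrow> (real ^ 'n) set"
  assumes "m \<ge> 2"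
    and "compact T"
    and "\<And>i. i < m \<Longrightarrow> semiellipsoid (S i)"
    and "T = (\<Inter>i<m. S i)"
  shows "\<exists>d\<le>2 * m - 3. generalized_ellipsoid d T"
proof -
  obtain N :: "real set" and w where N: "finite N" "card N = m" "N \<subseteq> {-1..1}"
    and deg: "\<And>x. x \<in> N \<Longrightarrow> degree (w x) \<le> 2 * m - 3"
    and one: "\<And>x. x \<in> N \<Longrightarrow> poly (w x) x = 1"
    and nonneg: "\<And>x s. x \<in> N \<Longrightarrow> s \<in> {-1..1} \<Longrightarrow> 0 \<le> poly (w x) s"
    and sum1: "(\<Sum>x\<in>N. w x) = 1"
  proof -
    have "2 * (m - 2) + 1 = 2 * m - 3" "m - 2 + 2 = m" using assms(1) by auto
    then show ?thesis
      using exists_interpolating_partition_of_unity[of "m - 2"] that by metis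
  qed
  obtain f where f: "bij_betw f N {..<m}"
    using ex_bij_betw_finite_nat[OF N(1)] N(2) by (auto simp: atLeast0LessThan)
  obtain A where psd: "\<And>i. i < m \<Longrightarrow> psd (A i)"
    and S: "\<And>i. i < m \<Longrightarrow> S i = {x. x \<bullet> (A i *v x) \<le> 1}"
    using assms(3) unfolding semiellipsoid_def by metis
  define M where "M x = A (f x)" for x
  have fm: "f x < m" if "x \<in> N" for x
    using f that by (auto simp: bij_betw_def)
  have T: "T = {v. \<forall>x\<in>N. v \<bullet> (M x *v v) \<le> 1}"
  proof -
    have "T = (\<Inter>i\<in>f ` N. S i)" using assms(4) f by (simp add: bij_betw_def)
    also have "\<dots> = {v. \<forall>x\<in>N. v \<bullet> (M x *v v) \<le> 1}"
      using S fm by (auto simp: M_def)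
    finally show ?thesis .
  qed
  have "generalized_ellipsoid (2 * m - 3) T"
    by (rule generalized_ellipsoid_if_interpolating_weights
        [OF N(1,3) deg one nonneg sum1 _ T compact_imp_bounded[OF assms(2)]])
      (simp_all add: M_def psd fm)
  then show ?thesis by blast
qed

end
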